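(* Let $n$ and $k$ be positive integers such that $2\leq k\leq 2n-3$. Then there exists a connected simple graph $G$ with $n$ vertices such that $s(G)=k$.
   Context: A vertex labeling of a graph $G$ is an injective map $f:V(G)\to\mathbb{Z}$. It induces the edge labeling $f^+:E(G)\to\mathbb{Z}$, $f^+(uv)=f(u)+f(v)$, and $|f^+|$ denotes the number of distinct values $f^+$ takes on $E(G)$. The sum index $s(G)$ is the minimum positive integer $k$ such that there exists a vertex labeling $f$ of $G$ with $|f^+|=k$. *)

theory Defs
  imports "Graph_Theory.Graph_Theory"
begin

text \<open>
  A finite simple graph is a \<open>pair_graph\<close>: a finite, loop-free digraph with a symmetric arc
  relation, in which the edge \<open>uv\<close> is the pair of arcs \<open>(u, v)\<close> and \<open>(v, u)\<close>. Both arcs get the same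
  label under \<open>edge_label\<close>, so the labels of arcs are exactly the labels of edges.
\<close>

definition vertex_labeling :: "'a pair_pre_digraph \<Rightarrow> ('a \<Rightarrow> int) \<Rightarrow> bool" where
  "vertex_labeling G f \<longleftrightarrow> inj_on f (pverts G)"

definition edge_label :: "('a \<Rightarrow> int) \<Rightarrow> 'a \<times> 'a \<Rightarrow> int" where
  "edge_label f e = f (fst e) + f (snd e)"

definition num_edge_labels :: "'a pair_pre_digraph \<Rightarrow> ('a \<Rightarrow> int) \<Rightarrow> nat" where
  "num_edge_labels G f = card (edge_label f ` parcs G)"

text \<open>Only meaningful for finite graphs with at least one edge; otherwise no positive \<open>k\<close> is
  attained.\<close>

definition sum_index :: "'a pair_pre_digraph \<Rightarrow> nat" where
  "sum_index G = (LEAST k. 0 < k \<and> (\<exists>f. vertex_labeling G f \<and> num_edge_labels G f = k))"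

end

theory Submission
  imports Defs
begin

text \<open>
  The sum index obeys a discrete intermediate value property along chains of graphs on a fixed
  vertex set. If \<open>f\<close> attains the sum index of \<open>G\<close>, then \<open>f\<close> also labels the graph \<open>G + uv\<close>, and it
  has at most one label more there, namely \<open>f u + f v\<close>. So adding one edge raises the sum index by
  at most one (\<open>sum_index_add_edge_le\<close>), and every value between the sum indices of a graph and of
  a supergraph on the same vertices is the sum index of some graph in between
  (\<open>sum_index_intermediate\<close>).

  Start from the path on \<open>n\<close> vertices and end at the complete graph; every graph in between contains
  the path and is therefore connected. The path has sum index at most \<open>2\<close>: with the vertex labels
  \<open>0, -1, 1, -2, 2, \<dots>\<close> along it, consecutive labels add up to \<open>-1\<close> or \<open>0\<close>. The complete graph has
  sum index at least \<open>2 * n - 3\<close>: \<open>n\<close> distinct integers have at least \<open>2 * n - 3\<close> sums of two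
  distinct members, because the sums involving the least and those involving the greatest of them
  number \<open>n - 1\<close> each and coincide only in the sum of these two.
\<close>

section \<open>The sum index as a minimum\<close>

lemma sum_index_le:
  assumes "vertex_labeling G f" and "finite (parcs G)" and "parcs G \<noteq> {}"
  shows "sum_index G \<le> num_edge_labels G f"
proof -
  have "0 < num_edge_labels G f"
    using assms by (simp add: num_edge_labels_def card_gt_0_iff)
  then show ?thesis
    unfolding sum_index_def using assms(1) by (intro Least_le) blast
qed

lemma sum_index_attained:
  assumes "finite (pverts G)" and "finite (parcs G)" and "parcs G \<noteq> {}"
  obtains f where "vertex_labeling G f" and "num_edge_labels G f = sum_index G"
proof -
  obtain h :: "'a \<Rightarrow> nat" where "inj_on h (pverts G)"
    using finite_imp_inj_to_nat_seg[OF assms(1)] by blast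
  then have "inj_on (int \<circ> h) (pverts G)"
    by (intro comp_inj_on inj_on_of_nat)
  moreover have "0 < num_edge_labels G (int \<circ> h)"
    using assms by (simp add: num_edge_labels_def card_gt_0_iff)
  ultimately have
    "\<exists>k. 0 < k \<and> (\<exists>f. vertex_labeling G f \<and> num_edge_labels G f = k)"
    by (auto simp: vertex_labeling_def)
  from LeastI_ex[OF this] show thesis
    using that unfolding sum_index_def by blast
qed

section \<open>Intermediate values along chains of graphs\<close>

lemma sum_index_add_edge_le:
  assumes "finite V" and "finite E" and "E \<noteq> {}"
  shows "sum_index \<lparr>pverts = V, parcs = insert (u, v) (insert (v, u) E)\<rparr>
    \<le> Suc (sum_index \<lparr>pverts = V, parcs = E\<rparr>)" (is "sum_index ?H \<le> Suc (sum_index ?G)")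
proof -
  obtain f where f: "vertex_labeling ?G f" "num_edge_labels ?G f = sum_index ?G"
    using sum_index_attained[of ?G] assms by auto
  have "edge_label f ` parcs ?H = insert (f u + f v) (edge_label f ` E)"
    by (simp add: edge_label_def add.commute)
  then have "num_edge_labels ?H f \<le> Suc (num_edge_labels ?G f)"
    using assms(2) by (simp add: num_edge_labels_def card_insert_if)
  moreover have "sum_index ?H \<le> num_edge_labels ?H f"
    using f(1) assms by (intro sum_index_le) (auto simp: vertex_labeling_def)
  ultimately show ?thesis
    using f(2) by linarith
qed

text \<open>
  Rather than following a chain of graphs, take a largest arc set whose sum index does not exceed
  \<open>k\<close>: if its sum index were smaller than \<open>k\<close>, one more edge could be added.
\<close>

lemma sum_index_intermediate:
  assumes "finite V" and "finite B" and "A \<noteq> {}" and "A \<subseteq> B" and "sym A" and "sym B"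
    and "sum_index \<lparr>pverts = V, parcs = A\<rparr> \<le> k"
    and "k \<le> sum_index \<lparr>pverts = V, parcs = B\<rparr>"
  obtains E where "A \<subseteq> E" and "E \<subseteq> B" and "sym E"
    and "sum_index \<lparr>pverts = V, parcs = E\<rparr> = k"
proof -
  let ?s = "\<lambda>E. sum_index \<lparr>pverts = V, parcs = E\<rparr>"
  define F where "F = {E. A \<subseteq> E \<and> E \<subseteq> B \<and> sym E \<and> ?s E \<le> k}"
  have "finite F"
    by (rule finite_subset[of _ "Pow B"]) (use assms(2) in \<open>auto simp: F_def\<close>)
  moreover have "A \<in> F"
    using assms by (simp add: F_def)
  ultimately have "\<exists>E\<in>F. A \<subseteq> E \<and> (\<forall>E'\<in>F. E \<subseteq> E' \<longrightarrow> E = E')"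
    by (rule finite_has_maximal2)
  then obtain E where "E \<in> F" and maximal: "\<And>E'. E' \<in> F \<Longrightarrow> E \<subseteq> E' \<Longrightarrow> E' = E"
    by blast
  then have E: "A \<subseteq> E" "E \<subseteq> B" "sym E" "?s E \<le> k"
    by (simp_all add: F_def)
  have "?s E = k"
  proof (rule ccontr)
    assume "?s E \<noteq> k"
    with E(4) have less: "?s E < k"
      by simp
    with assms(8) have "E \<noteq> B"
      by auto
    with E(2) obtain u v where uv: "(u, v) \<in> B" "(u, v) \<notin> E"
      by (meson subset_antisym subrelI)
    let ?E' = "insert (u, v) (insert (v, u) E)"
    have "finite E" "E \<noteq> {}"
      using E(1,2) assms(2,3) finite_subset[of E B] by auto
    then have "?s ?E' \<le> k"
      using sum_index_add_edge_le[OF assms(1), of E u v] less by linarith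
    moreover have "A \<subseteq> ?E'" "?E' \<subseteq> B" "sym ?E'"
      using E(1-3) uv(1) assms(6) by (auto simp: sym_def)
    ultimately have "?E' = E"
      by (intro maximal) (auto simp: F_def)
    with uv(2) show False
      by blast
  qed
  with E(1-3) show thesis
    by (rule that)
qed

section \<open>The path\<close>

definition path_arcs :: "nat \<Rightarrow> nat rel" where
  "path_arcs n = {(i, j). i < n \<and> j < n \<and> (j = Suc i \<or> i = Suc j)}"

lemma sum_index_path_le:
  assumes "2 \<le> n"
  shows "sum_index \<lparr>pverts = {..<n}, parcs = path_arcs n\<rparr> \<le> 2" (is "sum_index ?P \<le> 2")
proof -
  define f where "f i = (if even i then int (i div 2) else - int (i div 2) - 1)" for i
  have f_even: "f (2 * a) = int a" and f_odd: "f (Suc (2 * a)) = - int a - 1" for a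
    by (simp_all add: f_def)
  have "inj f"
  proof (rule injI)
    fix i j
    assume eq: "f i = f j"
    obtain a where "i = 2 * a \<or> i = Suc (2 * a)"
      by (metis evenE oddE Suc_eq_plus1)
    moreover obtain b where "j = 2 * b \<or> j = Suc (2 * b)"
      by (metis evenE oddE Suc_eq_plus1)
    ultimately show "i = j"
      using eq f_even[of a] f_odd[of a] f_even[of b] f_odd[of b] by (elim disjE) simp_all
  qed
  then have label: "vertex_labeling ?P f"
    by (simp add: vertex_labeling_def inj_on_def)
  have consecutive: "f i + f (Suc i) \<in> {-1, 0}" for i
  proof (cases "even i")
    case True
    then obtain a where "i = 2 * a"
      by (rule evenE)
    then show ?thesis
      using f_even[of a] f_odd[of a] by simp
  next
    case False
    then obtain a where "i = Suc (2 * a)"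
      by (metis oddE Suc_eq_plus1)
    then show ?thesis
      using f_odd[of a] f_even[of "Suc a"] by simp
  qed
  have "edge_label f ` parcs ?P \<subseteq> {-1, 0}"
  proof (rule image_subsetI)
    fix e
    assume "e \<in> parcs ?P"
    then obtain i where "e = (i, Suc i) \<or> e = (Suc i, i)"
      by (auto simp: path_arcs_def)
    then show "edge_label f e \<in> {-1, 0}"
      using consecutive[of i] by (auto simp: edge_label_def add.commute)
  qed
  from card_mono[OF _ this] have "num_edge_labels ?P f \<le> 2"
    by (simp add: num_edge_labels_def)
  moreover have "finite (path_arcs n)"
    by (rule finite_subset[of _ "{..<n} \<times> {..<n}"]) (auto simp: path_arcs_def)
  moreover have "(0, 1) \<in> path_arcs n"
    using assms by (simp add: path_arcs_def)
  ultimately show ?thesis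
    using sum_index_le[OF label] by fastforce
qed

lemma connected_if_path_arcs_subset:
  assumes "pair_graph G" and "pverts G = {..<n}" and "path_arcs n \<subseteq> parcs G" and "0 < n"
  shows "Digraph_Component.connected (with_proj G)"
proof -
  interpret G: pair_graph G
    by (fact assms(1))
  have from_0: "0 \<rightarrow>\<^sup>*\<^bsub>with_proj G\<^esub> i" if "i < n" for i
    using that
  proof (induction i)
    case 0
    then show ?case
      using assms(2) by (intro G.reachable_refl) simp
  next
    case (Suc i)
    then have "(i, Suc i) \<in> parcs G"
      using assms(3) by (auto simp: path_arcs_def)
    moreover have "0 \<rightarrow>\<^sup>*\<^bsub>with_proj G\<^esub> i"
      using Suc by simp
    ultimately show ?case
      using G.reachable_adj_trans[of 0 i "Suc i"] by simp
  qed
  have "u \<rightarrow>\<^sup>*\<^bsub>with_proj G\<^esub> v" if "u < n" "v < n" for u v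
    using G.reachable_trans[OF G.symmetric_reachable'[OF from_0[OF that(1)]] from_0[OF that(2)]] .
  then show ?thesis
    unfolding Digraph_Component.connected_def
    using assms(2,4) by (intro strongly_connectedI G.reachable_mk_symmetricI) auto
qed

section \<open>The complete graph\<close>

definition complete_arcs :: "'a set \<Rightarrow> 'a rel" where
  "complete_arcs V = {(u, v). u \<in> V \<and> v \<in> V \<and> u \<noteq> v}"

lemma card_sums_of_distinct_ge:
  fixes A :: "'a::linordered_ab_group_add set"
  assumes "finite A" and "2 \<le> card A"
  shows "2 * card A - 3 \<le> card ((\<lambda>(a, b). a + b) ` complete_arcs A)"
proof -
  let ?S = "(\<lambda>(a, b). a + b) ` complete_arcs A"
  define l where "l = Min A"
  define m where "m = Max A"
  have "A \<noteq> {}"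
    using assms(2) by auto
  then have lm: "l \<in> A" "m \<in> A"
    using assms(1) by (auto simp: l_def m_def)
  have bounds: "l \<le> a" "a \<le> m" if "a \<in> A" for a
    using assms(1) that by (auto simp: l_def m_def)
  let ?L = "(+) l ` (A - {l})"
  let ?M = "(+) m ` (A - {m})"
  have "finite (complete_arcs A)"
    by (rule finite_subset[of _ "A \<times> A"]) (use assms(1) in \<open>auto simp: complete_arcs_def\<close>)
  then have fin: "finite ?S"
    by blast
  have "?L \<inter> ?M \<subseteq> {l + m}"
  proof
    fix x
    assume x: "x \<in> ?L \<inter> ?M"
    from x obtain a where a: "a \<in> A" "x = l + a"
      by blast
    from x obtain b where b: "b \<in> A" "x = m + b"
      by blast
    have "l + a \<le> l + m" "m + l \<le> m + b"
      using bounds a(1) b(1) by simp_all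
    with a(2) b(2) show "x \<in> {l + m}"
      by (simp add: add.commute)
  qed
  from card_mono[OF _ this] have "card (?L \<inter> ?M) \<le> 1"
    by simp
  moreover have "card ?L = card A - 1" "card ?M = card A - 1"
    using lm by (simp_all add: card_image)
  moreover have "card ?L + card ?M = card (?L \<union> ?M) + card (?L \<inter> ?M)"
    using assms(1) by (intro card_Un_Int) auto
  moreover have "?L \<union> ?M \<subseteq> ?S"
    using lm by (force simp: complete_arcs_def)
  with fin have "card (?L \<union> ?M) \<le> card ?S"
    by (rule card_mono)
  ultimately show ?thesis
    by linarith
qed

lemma sum_index_complete_ge:
  assumes "finite V" and "2 \<le> card V"
  shows "2 * card V - 3 \<le> sum_index \<lparr>pverts = V, parcs = complete_arcs V\<rparr>" (is "_ \<le> sum_index ?K")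
proof -
  have "finite (complete_arcs V)"
    by (rule finite_subset[of _ "V \<times> V"]) (use assms(1) in \<open>auto simp: complete_arcs_def\<close>)
  moreover obtain u v where "u \<in> V" "v \<in> V" "u \<noteq> v"
    using assms(2) card_le_Suc0_iff_eq[OF assms(1)] by force
  then have "complete_arcs V \<noteq> {}"
    by (auto simp: complete_arcs_def)
  ultimately obtain f where f: "vertex_labeling ?K f" "num_edge_labels ?K f = sum_index ?K"
    using sum_index_attained[of ?K] assms(1) by (metis pair_pre_digraph.select_convs)
  have inj: "inj_on f V"
    using f(1) by (simp add: vertex_labeling_def)
  have "edge_label f ` complete_arcs V = (\<lambda>(a, b). a + b) ` map_prod f f ` complete_arcs V"
    by (simp add: image_image edge_label_def case_prod_unfold)
  also have "map_prod f f ` complete_arcs V = complete_arcs (f ` V)"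
    using inj by (force simp: complete_arcs_def inj_on_def)
  finally have "num_edge_labels ?K f = card ((\<lambda>(a, b). a + b) ` complete_arcs (f ` V))"
    by (simp add: num_edge_labels_def)
  moreover have "card (f ` V) = card V"
    using inj by (rule card_image)
  ultimately show ?thesis
    using card_sums_of_distinct_ge[of "f ` V"] assms f(2) by simp
qed

section \<open>Realising every admissible sum index\<close>

theorem theorem2p18:
  fixes n k :: nat
  assumes "0 < n" and "0 < k" and "2 \<le> k" and "k \<le> 2 * n - 3"
  shows "\<exists>G :: nat pair_pre_digraph.
           pair_graph G \<and> Digraph_Component.connected (with_proj G) \<and>
           card (pverts G) = n \<and> sum_index G = k"
proof -
  have n: "2 \<le> n"
    using assms by linarith
  have fin: "finite (complete_arcs {..<n})"
    by (rule finite_subset[of _ "{..<n} \<times> {..<n}"]) (auto simp: complete_arcs_def)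
  have "(0, 1) \<in> path_arcs n"
    using n by (simp add: path_arcs_def)
  then have nonempty: "path_arcs n \<noteq> {}"
    by blast
  have sub: "path_arcs n \<subseteq> complete_arcs {..<n}"
    by (auto simp: path_arcs_def complete_arcs_def)
  have sym: "sym (path_arcs n)" "sym (complete_arcs {..<n})"
    by (auto simp: path_arcs_def complete_arcs_def sym_def)
  have lower: "sum_index \<lparr>pverts = {..<n}, parcs = path_arcs n\<rparr> \<le> k"
    using sum_index_path_le[OF n] assms(3) by linarith
  have upper: "k \<le> sum_index \<lparr>pverts = {..<n}, parcs = complete_arcs {..<n}\<rparr>"
    using sum_index_complete_ge[of "{..<n}"] n assms(4) by simp
  obtain E where E: "path_arcs n \<subseteq> E" "E \<subseteq> complete_arcs {..<n}" "sym E"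
    "sum_index \<lparr>pverts = {..<n}, parcs = E\<rparr> = k"
    using sum_index_intermediate[OF finite_lessThan fin nonempty sub sym lower upper] by blast
  let ?G = "\<lparr>pverts = {..<n}, parcs = E\<rparr>"
  have "pair_graph ?G"
    using E(2,3) finite_subset[OF E(2) fin]
    by unfold_locales (auto simp: complete_arcs_def symmetric_def)
  moreover from this have "Digraph_Component.connected (with_proj ?G)"
    using E(1) assms(1) by (intro connected_if_path_arcs_subset) simp_all
  ultimately show ?thesis
    using E(4) by (intro exI[of _ ?G]) simp
qed

end
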